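(* Let $\Gamma$ be an abelian group and let $M$ be a conical refinement $\Gamma$-monoid. Let $I=\bigoplus_{k=1}^m I_k$ and $J=\bigoplus_{l=1}^n J_l$ be essential $\Gamma$-order ideals of $M$, where all the $I_k$ ($1\le k\le m$) and all the $J_l$ ($1\le l\le n$) are uniform $\Gamma$-order ideals of $M$. Then $m=n$.
   Context: All monoids are commutative, written additively with unit $0$. A $\Gamma$-monoid is a monoid $M$ with an action of the abelian group $\Gamma$ by monoid automorphisms. The algebraic preorder on $M$ is: $a\le b$ iff $b=a+c$ for some $c\in M$. $M$ is conical if $a+b=0$ implies $a=b=0$. $M$ is a refinement monoid if whenever $a_0+a_1=b_0+b_1$ there are $c_{00},c_{01},c_{10},c_{11}\in M$ with $a_0=c_{00}+c_{01}$, $a_1=c_{10}+c_{11}$, $b_0=c_{00}+c_{10}$, $b_1=c_{01}+c_{11}$. A $\Gamma$-order ideal of $M$ is a submonoid $I$ that is closed under the action of $\Gamma$ and such that $x\in I$, $y\le x$ imply $y\in I$. For a family of $\Gamma$-order ideals, $\sum_s I_s$ is the set of finite sums of elements of the $I_s$ (in a refinement monoid this is again a $\Gamma$-order ideal). The sum is called direct, written $\bigoplus_s I_s$, if $I_i\cap\sum_{s\ne i}I_s=\{0\}$ for every index $i$. A $\Gamma$-order ideal $I$ of $M$ is essential if $I\cap J\neq\{0\}$ for every nonzero $\Gamma$-order ideal $J$ of $M$. A nonzero $\Gamma$-order ideal $I$ is uniform if any two nonzero $\Gamma$-order ideals contained in $I$ have nonzero intersection. *)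

theory Defs
  imports Main
begin

text \<open>
  The monoid is the type \<open>'m\<close> of class \<open>comm_monoid_add\<close>; the acting abelian group is the
  type \<open>'g\<close> of class \<open>ab_group_add\<close>, so it is written additively too.
\<close>

definition monoid_automorphism :: "('m::comm_monoid_add \<Rightarrow> 'm) \<Rightarrow> bool" where
  "monoid_automorphism f \<longleftrightarrow> bij f \<and> f 0 = 0 \<and> (\<forall>x y. f (x + y) = f x + f y)"

locale gamma_monoid =
  fixes act :: "'g::ab_group_add \<Rightarrow> 'm::comm_monoid_add \<Rightarrow> 'm"
  assumes act_automorphism: "monoid_automorphism (act g)"
    and act_zero: "act 0 x = x"
    and act_add: "act (g + h) x = act g (act h x)"

definition alg_le :: "'m::comm_monoid_add \<Rightarrow> 'm \<Rightarrow> bool" where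
  "alg_le a b \<longleftrightarrow> (\<exists>c. b = a + c)"

definition conical :: "'m::comm_monoid_add itself \<Rightarrow> bool" where
  "conical _ \<longleftrightarrow> (\<forall>a b :: 'm. a + b = 0 \<longrightarrow> a = 0 \<and> b = 0)"

definition refinement_monoid :: "'m::comm_monoid_add itself \<Rightarrow> bool" where
  "refinement_monoid _ \<longleftrightarrow>
    (\<forall>a0 a1 b0 b1 :: 'm. a0 + a1 = b0 + b1 \<longrightarrow>
      (\<exists>c00 c01 c10 c11. a0 = c00 + c01 \<and> a1 = c10 + c11 \<and> b0 = c00 + c10 \<and> b1 = c01 + c11))"

definition submonoid_add :: "'m::comm_monoid_add set \<Rightarrow> bool" where
  "submonoid_add N \<longleftrightarrow> 0 \<in> N \<and> (\<forall>x\<in>N. \<forall>y\<in>N. x + y \<in> N)"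

definition gamma_order_ideal :: "('g \<Rightarrow> 'm::comm_monoid_add \<Rightarrow> 'm) \<Rightarrow> 'm set \<Rightarrow> bool" where
  "gamma_order_ideal act I \<longleftrightarrow>
    submonoid_add I \<and> (\<forall>g. \<forall>x\<in>I. act g x \<in> I) \<and> (\<forall>x\<in>I. \<forall>y. alg_le y x \<longrightarrow> y \<in> I)"

text \<open>For an empty family this is \<open>{0}\<close>, the only sum being the empty one.\<close>
definition family_sum :: "'i set \<Rightarrow> ('i \<Rightarrow> 'm::comm_monoid_add set) \<Rightarrow> 'm set" where
  "family_sum S A = {sum_list xs | xs. set xs \<subseteq> (\<Union>s\<in>S. A s)}"

definition is_direct_sum ::
    "'m::comm_monoid_add set \<Rightarrow> 'i set \<Rightarrow> ('i \<Rightarrow> 'm set) \<Rightarrow> bool" where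
  "is_direct_sum I S A \<longleftrightarrow>
    I = family_sum S A \<and> (\<forall>i\<in>S. A i \<inter> family_sum (S - {i}) A = {0})"

definition essential_ideal :: "('g \<Rightarrow> 'm::comm_monoid_add \<Rightarrow> 'm) \<Rightarrow> 'm set \<Rightarrow> bool" where
  "essential_ideal act I \<longleftrightarrow>
    gamma_order_ideal act I \<and>
    (\<forall>J. gamma_order_ideal act J \<and> J \<noteq> {0} \<longrightarrow> I \<inter> J \<noteq> {0})"

definition uniform_ideal :: "('g \<Rightarrow> 'm::comm_monoid_add \<Rightarrow> 'm) \<Rightarrow> 'm set \<Rightarrow> bool" where
  "uniform_ideal act I \<longleftrightarrow>
    gamma_order_ideal act I \<and> I \<noteq> {0} \<and>
    (\<forall>J K. gamma_order_ideal act J \<and> J \<noteq> {0} \<and> J \<subseteq> I \<and>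
           gamma_order_ideal act K \<and> K \<noteq> {0} \<and> K \<subseteq> I \<longrightarrow> J \<inter> K \<noteq> {0})"

end

theory Submission
  imports Defs
begin

text \<open>
  The idea is that of Goldie dimension. Call \<open>I\<^sub>k\<close> and \<open>J\<^sub>l\<close> linked if
  \<open>I\<^sub>k \<inter> J\<^sub>l \<noteq> {0}\<close>.

  Each \<open>I\<^sub>k\<close> is linked to some \<open>J\<^sub>l\<close>: as \<open>J\<close> is essential, \<open>I\<^sub>k\<close> contains a
  nonzero finite sum of elements of the \<open>J\<^sub>l\<close>, and the summands, lying below the sum, are
  again in \<open>I\<^sub>k\<close> (\<open>order_ideal_meets_summand\<close>). This is where order ideals are easier than
  submodules: single summands are at hand, without any projection.

  Two different \<open>I\<^sub>i\<close> and \<open>I\<^sub>k\<close> are never linked to the same \<open>J\<^sub>l\<close>: the intersections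
  \<open>I\<^sub>i \<inter> J\<^sub>l\<close> and \<open>I\<^sub>k \<inter> J\<^sub>l\<close> would be nonzero ideals inside the uniform ideal
  \<open>J\<^sub>l\<close>, so \<open>I\<^sub>i \<inter> I\<^sub>k \<noteq> {0}\<close>, against directness.

  Hence choosing a linked \<open>l\<close> for every \<open>k\<close> is injective and \<open>m \<le> n\<close>
  (\<open>card_direct_le_card_uniform\<close>); equality follows by symmetry.
\<close>

lemma gamma_order_idealD:
  assumes "gamma_order_ideal act A"
  shows gamma_order_ideal_zero: "0 \<in> A"
    and gamma_order_ideal_down: "x \<in> A \<Longrightarrow> alg_le y x \<Longrightarrow> y \<in> A"
  using assms unfolding gamma_order_ideal_def submonoid_add_def by blast+

lemma gamma_order_ideal_Int:
  assumes "gamma_order_ideal act A" "gamma_order_ideal act B"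
  shows "gamma_order_ideal act (A \<inter> B)"
  using assms unfolding gamma_order_ideal_def submonoid_add_def by blast

lemma alg_le_sum_list:
  assumes "y \<in> set xs"
  shows "alg_le y (sum_list xs)"
proof -
  obtain us vs where "xs = us @ y # vs"
    using split_list[OF assms] by blast
  then have "sum_list xs = y + (sum_list us + sum_list vs)"
    by (simp add: ac_simps)
  then show ?thesis
    unfolding alg_le_def by blast
qed

lemma sum_list_nonzeroE:
  fixes xs :: "'m::comm_monoid_add list"
  assumes "sum_list xs \<noteq> 0"
  obtains y where "y \<in> set xs" "y \<noteq> 0"
proof -
  have "\<exists>y\<in>set xs. y \<noteq> 0"
    using assms by (induction xs) auto
  then show thesis
    using that by blast
qed

lemma subset_family_sum:
  assumes "s \<in> S"
  shows "A s \<subseteq> family_sum S A"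
proof
  fix x assume "x \<in> A s"
  then have "set [x] \<subseteq> (\<Union>s\<in>S. A s)" "x = sum_list [x]"
    using assms by auto
  then show "x \<in> family_sum S A"
    unfolding family_sum_def by blast
qed

lemma direct_sum_pairwise_Int_zero:
  assumes direct: "is_direct_sum I S A" and "i \<in> S" "j \<in> S" "i \<noteq> j" and "0 \<in> A j"
  shows "A i \<inter> A j = {0}"
proof -
  have "A i \<inter> family_sum (S - {i}) A = {0}"
    using direct \<open>i \<in> S\<close> unfolding is_direct_sum_def by blast
  moreover have "A j \<subseteq> family_sum (S - {i}) A"
    using assms by (intro subset_family_sum) blast
  ultimately show ?thesis
    using \<open>0 \<in> A j\<close> by blast
qed

text \<open>An order ideal containing a nonzero sum contains each summand of it, and one is nonzero.\<close>

lemma order_ideal_meets_summand: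
  assumes K: "gamma_order_ideal act K" and "K \<inter> family_sum T B \<noteq> {0}"
    and "0 \<in> family_sum T B"
  obtains t where "t \<in> T" "K \<inter> B t \<noteq> {0}"
proof -
  obtain x where "x \<in> K" "x \<in> family_sum T B" "x \<noteq> 0"
    using assms gamma_order_ideal_zero[OF K] by blast
  then obtain xs where xs: "x = sum_list xs" "set xs \<subseteq> (\<Union>t\<in>T. B t)"
    unfolding family_sum_def by blast
  then obtain y where y: "y \<in> set xs" "y \<noteq> 0"
    using \<open>x \<noteq> 0\<close> sum_list_nonzeroE by metis
  have "y \<in> K"
    using gamma_order_ideal_down[OF K \<open>x \<in> K\<close>] alg_le_sum_list[OF y(1)] xs(1) by blast
  moreover obtain t where "t \<in> T" "y \<in> B t"
    using xs(2) y(1) by blast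
  ultimately show thesis
    using that y(2) by blast
qed

text \<open>
  The bound holds because sending \<open>s\<close> to some \<open>t\<close> with \<open>A s \<inter> B t \<noteq> {0}\<close> is injective: inside
  the uniform ideal \<open>B t\<close> there is no room for two nonzero ideals that intersect trivially.
\<close>

lemma card_direct_le_card_uniform:
  assumes ideal: "\<And>s. s \<in> S \<Longrightarrow> gamma_order_ideal act (A s)"
    and nonzero: "\<And>s. s \<in> S \<Longrightarrow> A s \<noteq> {0}"
    and direct: "is_direct_sum I S A"
    and "finite T"
    and uniform: "\<And>t. t \<in> T \<Longrightarrow> uniform_ideal act (B t)"
    and ess: "essential_ideal act (family_sum T B)"
  shows "card S \<le> card T"
proof -
  have zero: "0 \<in> family_sum T B"
    using ess[unfolded essential_ideal_def] by (intro gamma_order_ideal_zero) (rule conjunct1)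
  have "\<exists>t\<in>T. A s \<inter> B t \<noteq> {0}" if s: "s \<in> S" for s
  proof -
    have "family_sum T B \<inter> A s \<noteq> {0}"
      using ess ideal[OF s] nonzero[OF s] unfolding essential_ideal_def by blast
    then have "A s \<inter> family_sum T B \<noteq> {0}"
      by (simp only: Int_commute not_False_eq_True)
    then obtain t where "t \<in> T" "A s \<inter> B t \<noteq> {0}"
      by (rule order_ideal_meets_summand[OF ideal[OF s] _ zero])
    then show ?thesis ..
  qed
  then have "\<forall>s\<in>S. \<exists>t. t \<in> T \<and> A s \<inter> B t \<noteq> {0}"
    by blast
  then obtain f where "\<forall>s\<in>S. f s \<in> T \<and> A s \<inter> B (f s) \<noteq> {0}"
    by (rule bchoice[THEN exE])
  then have f: "f s \<in> T" and linked: "A s \<inter> B (f s) \<noteq> {0}" if "s \<in> S" for s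
    using that by simp_all
  have "inj_on f S"
  proof (rule inj_onI, rule ccontr)
    fix s s' assume s: "s \<in> S" "s' \<in> S" "f s = f s'" "s \<noteq> s'"
    let ?B = "B (f s)"
    have B: "uniform_ideal act ?B"
      using uniform f s(1) by blast
    then have "gamma_order_ideal act ?B"
      unfolding uniform_ideal_def by blast
    then have "gamma_order_ideal act (A s \<inter> ?B)" "gamma_order_ideal act (A s' \<inter> ?B)"
      by (auto intro!: gamma_order_ideal_Int ideal s(1,2))
    moreover have "A s \<inter> ?B \<noteq> {0}" "A s' \<inter> ?B \<noteq> {0}"
      using linked[OF s(1)] linked[OF s(2)] s(3) by simp_all
    moreover have "A s \<inter> ?B \<subseteq> ?B" "A s' \<inter> ?B \<subseteq> ?B"
      by (rule Int_lower2)+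
    ultimately have meet: "(A s \<inter> ?B) \<inter> (A s' \<inter> ?B) \<noteq> {0}"
      using B[unfolded uniform_ideal_def] by presburger
    have "A s \<inter> A s' = {0}"
      by (rule direct_sum_pairwise_Int_zero[OF direct s(1,2,4)
            gamma_order_ideal_zero[OF ideal[OF s(2)]]])
    moreover have "0 \<in> ?B"
      using \<open>gamma_order_ideal act ?B\<close> by (rule gamma_order_ideal_zero)
    ultimately show False
      using meet by blast
  qed
  then show ?thesis
    using f \<open>finite T\<close> card_inj_on_le by blast
qed

theorem theorem2p10:
  fixes act :: "'g::ab_group_add \<Rightarrow> 'm::comm_monoid_add \<Rightarrow> 'm"
    and I J :: "'m set"
    and Is Js :: "nat \<Rightarrow> 'm set"
    and m n :: nat
  assumes "gamma_monoid act"
    and "conical TYPE('m)"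
    and "refinement_monoid TYPE('m)"
    and "\<And>k. k \<in> {1..m} \<Longrightarrow> uniform_ideal act (Is k)"
    and "\<And>l. l \<in> {1..n} \<Longrightarrow> uniform_ideal act (Js l)"
    and "is_direct_sum I {1..m} Is"
    and "is_direct_sum J {1..n} Js"
    and "essential_ideal act I"
    and "essential_ideal act J"
  shows "m = n"
proof (rule antisym)
  have sums: "I = family_sum {1..m} Is" "J = family_sum {1..n} Js"
    using assms(6,7) unfolding is_direct_sum_def by blast+
  have Is: "gamma_order_ideal act (Is k)" "Is k \<noteq> {0}" if "k \<in> {1..m}" for k
    using assms(4)[OF that] unfolding uniform_ideal_def by blast+
  have Js: "gamma_order_ideal act (Js l)" "Js l \<noteq> {0}" if "l \<in> {1..n}" for l
    using assms(5)[OF that] unfolding uniform_ideal_def by blast+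
  have "card {1..m} \<le> card {1..n}"
    using card_direct_le_card_uniform[OF Is assms(6) finite_atLeastAtMost assms(5)
        assms(9)[unfolded sums(2)]] .
  then show "m \<le> n" by simp
  have "card {1..n} \<le> card {1..m}"
    using card_direct_le_card_uniform[OF Js assms(7) finite_atLeastAtMost assms(4)
        assms(8)[unfolded sums(1)]] .
  then show "n \<le> m" by simp
qed

end
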